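(* Let $q>4$ and let $\pi_q$ be a projective plane of order $q$. Then $G_{q+1}\hookrightarrow\pi_q$. Furthermore, this is the largest gear graph that can be embedded in $\pi_q$; that is, $G_n$ does not embed in $\pi_q$ for any $n>q+1$.
   Context: Graphs are simple, finite and undirected. The gear graph $G_n$ (for an integer $n\ge 3$) is the graph on $2n+1$ vertices with $3n$ edges consisting of a $2n$-cycle $x_1x_2\cdots x_{2n}x_1$ together with one additional vertex, the center, that is adjacent to every second vertex of the cycle, i.e. exactly to $x_1,x_3,\dots,x_{2n-1}$ (so the center has degree $n$). A (finite) projective plane of order $q$ is an arbitrary one, not necessarily Desarguesian: it has $q^2+q+1$ points and $q^2+q+1$ lines, every line contains $q+1$ points, and every point is incident with $q+1$ lines. An embedding of a graph $G=(V,E)$ into a plane with point set $\mathcal{P}$ and line set $\mathcal{L}$ is an injective function $\psi:V\to\mathcal{P}$ such that the induced map $\overline{\psi}:E\to\mathcal{L}$, sending an edge $uv$ to the unique line through $\psi(u)$ and $\psi(v)$, is also injective (different edges use different whole lines). If such a $\psi$ exists, $G$ embeds in the plane; this is denoted by $\hookrightarrow$. *)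

theory Defs
  imports Main
begin

type_synonym 'v graph = "'v set \<times> 'v set set"

definition simple_graph :: "'v graph \<Rightarrow> bool" where
  "simple_graph G \<longleftrightarrow> finite (fst G) \<and> (\<forall>e\<in>snd G. e \<subseteq> fst G \<and> card e = 2)"

datatype gear_vertex = Center | Rim nat

definition gear_vertices :: "nat \<Rightarrow> gear_vertex set" where
  "gear_vertices n = insert Center (Rim ` {1..2 * n})"

definition gear_edges :: "nat \<Rightarrow> gear_vertex set set" where
  "gear_edges n =
     {{Rim i, Rim (i + 1)} | i. 1 \<le> i \<and> i < 2 * n} \<union> {{Rim (2 * n), Rim 1}} \<union>
     {{Center, Rim i} | i. 1 \<le> i \<and> i \<le> 2 * n \<and> odd i}"

text \<open>Only meaningful for \<open>n \<ge> 3\<close>.\<close>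

definition gear_graph :: "nat \<Rightarrow> gear_vertex graph" where
  "gear_graph n = (gear_vertices n, gear_edges n)"

lemma simple_graph_gear_graph:
  assumes "n \<ge> 3"
  shows "simple_graph (gear_graph n)"
proof -
  have "e \<subseteq> gear_vertices n \<and> card e = 2" if "e \<in> gear_edges n" for e
  proof -
    from that consider i where "e = {Rim i, Rim (i + 1)}" "1 \<le> i" "i < 2 * n"
      | "e = {Rim (2 * n), Rim 1}"
      | i where "e = {Center, Rim i}" "1 \<le> i" "i \<le> 2 * n"
      unfolding gear_edges_def by blast
    then show ?thesis
      using assms by cases (simp_all add: gear_vertices_def)
  qed
  then show ?thesis
    by (simp add: simple_graph_def gear_graph_def gear_vertices_def)
qed

lemma card_gear_vertices: "card (gear_vertices n) = 2 * n + 1"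
proof -
  have "card (Rim ` {1..2 * n}) = 2 * n"
    by (subst card_image) (auto simp: inj_on_def)
  moreover have "Center \<notin> Rim ` {1..2 * n}"
    by auto
  ultimately show ?thesis
    by (simp add: gear_vertices_def)
qed

lemma card_gear_edges:
  assumes "n \<ge> 3"
  shows "card (gear_edges n) = 3 * n"
proof -
  define A where "A = (\<lambda>i. {Rim i, Rim (i + 1)}) ` {1..<2 * n}"
  define B where "B = (\<lambda>j. {Center, Rim (2 * j + 1)}) ` {..<n}"
  have split: "gear_edges n = insert {Rim (2 * n), Rim 1} (A \<union> B)"
  proof -
    have "{{Rim i, Rim (i + 1)} | i. 1 \<le> i \<and> i < 2 * n} = A"
      unfolding A_def by fastforce
    moreover have "{i. 1 \<le> i \<and> i \<le> 2 * n \<and> odd i} = (\<lambda>j. 2 * j + 1) ` {..<n}"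
      by (auto simp: image_iff Bex_def elim!: oddE)
    then have "{{Center, Rim i} | i. 1 \<le> i \<and> i \<le> 2 * n \<and> odd i} = B"
      unfolding B_def by (simp add: setcompr_eq_image image_image)
    ultimately show ?thesis
      unfolding gear_edges_def by simp
  qed
  have "inj_on (\<lambda>i. {Rim i, Rim (i + 1)}) {1..<2 * n}"
    by (auto simp: inj_on_def doubleton_eq_iff)
  then have "card A = 2 * n - 1"
    by (simp add: A_def card_image)
  moreover have "inj_on (\<lambda>j. {Center, Rim (2 * j + 1)}) {..<n}"
    by (auto simp: inj_on_def doubleton_eq_iff)
  then have "card B = n"
    by (simp add: B_def card_image)
  moreover have "A \<inter> B = {}" "finite A" "finite B"
    by (auto simp: A_def B_def doubleton_eq_iff)
  moreover have "{Rim (2 * n), Rim 1} \<notin> A \<union> B"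
  proof -
    have "{Rim (2 * n), Rim 1} \<noteq> {Rim i, Rim (i + 1)}" if "i < 2 * n" for i
      unfolding doubleton_eq_iff gear_vertex.inject using assms that by linarith
    then have "{Rim (2 * n), Rim 1} \<notin> A"
      unfolding A_def image_iff Bex_def atLeastLessThan_iff by blast
    moreover have "{Rim (2 * n), Rim 1} \<notin> B"
      by (auto simp: B_def)
    ultimately show ?thesis
      by simp
  qed
  ultimately show ?thesis
    using assms by (simp add: split card_Un_disjoint)
qed

text \<open>Lines are represented by their point sets.\<close>

locale projective_plane =
  fixes points :: "'p set" and lines :: "'p set set"
  assumes finite_points: "finite points"
    and lines_subset: "l \<in> lines \<Longrightarrow> l \<subseteq> points"
    and unique_line: "\<lbrakk>a \<in> points; b \<in> points; a \<noteq> b\<rbrakk> \<Longrightarrow> \<exists>!l. l \<in> lines \<and> a \<in> l \<and> b \<in> l"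
    and unique_point: "\<lbrakk>l \<in> lines; m \<in> lines; l \<noteq> m\<rbrakk> \<Longrightarrow> \<exists>!a. a \<in> l \<and> a \<in> m"
    and quadrangle: "\<exists>S \<subseteq> points. card S = 4 \<and> (\<forall>l\<in>lines. card (S \<inter> l) \<le> 2)"

locale projective_plane_of_order = projective_plane points lines
  for q :: nat and points :: "'p set" and lines :: "'p set set" +
  assumes card_line: "l \<in> lines \<Longrightarrow> card l = q + 1"

definition induced_line :: "'p set set \<Rightarrow> ('v \<Rightarrow> 'p) \<Rightarrow> 'v set \<Rightarrow> 'p set" where
  "induced_line lines \<psi> e = (THE l. l \<in> lines \<and> \<psi> ` e \<subseteq> l)"

definition embedding :: "'v graph \<Rightarrow> 'p set \<Rightarrow> 'p set set \<Rightarrow> ('v \<Rightarrow> 'p) \<Rightarrow> bool" where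
  "embedding G points lines \<psi> \<longleftrightarrow>
     \<psi> ` fst G \<subseteq> points \<and> inj_on \<psi> (fst G) \<and> inj_on (induced_line lines \<psi>) (snd G)"

definition embeds :: "'v graph \<Rightarrow> 'p set \<Rightarrow> 'p set set \<Rightarrow> bool" where
  "embeds G points lines \<longleftrightarrow> (\<exists>\<psi>. embedding G points lines \<psi>)"

end

theory Submission
  imports Defs
begin

text \<open>
  Spokes of an embedded gear lie on different lines through the image of the center, and only
  \<open>q + 1\<close> lines pass through a point, so a gear with more than \<open>q + 1\<close> spokes does not embed.

  For the construction, observe that a gear is bipartite: one class consists of the rim vertices
  joined to the center, the other of the center and the remaining rim vertices. If the first class
  is placed on a line \<open>m\<close> and the second off \<open>m\<close>, then the line of an edge meets \<open>m\<close> only in one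
  point, which identifies one end of the edge. All that remains to be arranged is a local
  condition: from each vertex on \<open>m\<close>, its three neighbours are seen along different lines
  (\<open>embedding_if_one_class_on_line\<close>).

  Let \<open>a 1, \<dots>, a (q + 1)\<close> be all points of \<open>m\<close> and let \<open>C\<close>, the image of the center, lie off \<open>m\<close>.
  Write \<open>b i\<close> for the rim vertex between \<open>a i\<close> and \<open>a (i + 1)\<close>, cyclically. On the line \<open>k\<close> joining
  \<open>C\<close> to \<open>a (q + 1)\<close> there are exactly \<open>q - 1\<close> further points; they are used as
  \<open>b 1, \<dots>, b (q - 1)\<close>. A point off \<open>k\<close> sees different points of \<open>k\<close> along different lines, so the
  local condition holds for all edges between these vertices. Only \<open>b q\<close> and \<open>b (q + 1)\<close> are left.
  They are taken on the lines joining \<open>C\<close> to \<open>a 1\<close> and to \<open>a 2\<close>, respectively. These two points of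
  \<open>m\<close> are not rim neighbours of \<open>b q\<close> and of \<open>b (q + 1)\<close>, so no rim edge runs through \<open>C\<close>. What is
  left is to avoid three and four other lines, respectively; as a line has \<open>q + 1 > 4\<close> points, this
  is possible.
\<close>

section \<open>Joins and pencils in a projective plane\<close>

context projective_plane
begin

definition join :: "'p \<Rightarrow> 'p \<Rightarrow> 'p set" where
  "join a b = (THE l. l \<in> lines \<and> a \<in> l \<and> b \<in> l)"

lemma join:
  assumes "a \<in> points" "b \<in> points" "a \<noteq> b"
  shows "join a b \<in> lines" "a \<in> join a b" "b \<in> join a b"
  using theI'[OF unique_line[OF assms]] by (simp_all add: join_def)

lemma same_line:
  assumes "l \<in> lines" "m \<in> lines" "a \<in> l" "b \<in> l" "a \<in> m" "b \<in> m" "a \<noteq> b"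
  shows "l = m"
  using assms unique_line[of a b] lines_subset by blast

lemma induced_line_doubleton:
  assumes "\<psi> u \<in> points" "\<psi> v \<in> points" "\<psi> u \<noteq> \<psi> v"
  shows "induced_line lines \<psi> {u, v} = join (\<psi> u) (\<psi> v)"
  by (simp add: induced_line_def join_def)

definition collinear :: "'p \<Rightarrow> 'p \<Rightarrow> 'p \<Rightarrow> bool" where
  "collinear a b c \<longleftrightarrow> (\<exists>l\<in>lines. a \<in> l \<and> b \<in> l \<and> c \<in> l)"

lemma not_collinear_off_line:
  assumes "l \<in> lines" "b \<in> l" "c \<in> l" "b \<noteq> c" "a \<notin> l"
  shows "\<not> collinear a b c"
  using assms same_line unfolding collinear_def by blast

lemma collinear_swap: "collinear a b c \<longleftrightarrow> collinear a c b"
  by (auto simp: collinear_def)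

text \<open>
  A line joining \<open>p\<close> to a point of the quadrangle contains at most two points of the quadrangle, and
  a third one together with the chosen one spans a line that misses \<open>p\<close>.
\<close>

lemma exists_line_avoiding_point:
  assumes "p \<in> points"
  obtains l where "l \<in> lines" "p \<notin> l"
proof -
  obtain S where S: "S \<subseteq> points" "card S = 4" "\<And>l. l \<in> lines \<Longrightarrow> card (S \<inter> l) \<le> 2"
    using quadrangle by blast
  have "\<not> S \<subseteq> {p}"
    using S(2) card_mono[of "{p}" S] by auto
  then obtain x where x: "x \<in> S" "x \<noteq> p" by blast
  then have xp: "join x p \<in> lines" "x \<in> join x p" "p \<in> join x p"
    using join assms S(1) by auto
  have "\<not> S \<subseteq> join x p"
  proof
    assume "S \<subseteq> join x p"
    then have "S \<inter> join x p = S" by blast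
    then show False using S(2) S(3)[OF xp(1)] by simp
  qed
  then obtain y where y: "y \<in> S" "y \<notin> join x p" by blast
  then have xy: "join x y \<in> lines" "x \<in> join x y" "y \<in> join x y"
    using join[of x y] x S(1) xp by auto
  have "p \<notin> join x y"
    using same_line[OF xy(1) xp(1)] xy xp x y by blast
  then show ?thesis using that xy(1) by blast
qed

lemma exists_point: obtains p where "p \<in> points"
proof -
  obtain S where "S \<subseteq> points" "card S = 4" using quadrangle by blast
  then have "S \<noteq> {}" by auto
  then show ?thesis using that \<open>S \<subseteq> points\<close> by blast
qed

lemma finite_line: "l \<in> lines \<Longrightarrow> finite l"
  using lines_subset finite_points finite_subset by blast

end

context projective_plane_of_order
begin

text \<open>
  Fix a line that misses \<open>p\<close>. A line through \<open>p\<close> is determined by the point in which it meets the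
  fixed line.
\<close>

lemma card_pencil_le:
  assumes "p \<in> points"
  shows "finite {l \<in> lines. p \<in> l}" "card {l \<in> lines. p \<in> l} \<le> q + 1"
proof -
  obtain m where m: "m \<in> lines" "p \<notin> m"
    using exists_line_avoiding_point[OF assms] .
  define f where "f l = (SOME x. x \<in> l \<and> x \<in> m)" for l
  have f: "f l \<in> l \<and> f l \<in> m" if "l \<in> lines" "p \<in> l" for l
  proof -
    have "\<exists>x. x \<in> l \<and> x \<in> m"
      using unique_point[OF that(1) m(1)] that(2) m(2) by blast
    then show ?thesis unfolding f_def by (rule someI_ex)
  qed
  have inj: "inj_on f {l \<in> lines. p \<in> l}"
  proof (rule inj_onI)
    fix l l' assume a: "l \<in> {l \<in> lines. p \<in> l}" "l' \<in> {l \<in> lines. p \<in> l}" "f l = f l'"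
    show "l = l'"
      by (rule same_line[of l l' p "f l"]) (use a f[of l] f[of l'] m(2) in auto)
  qed
  have sub: "f ` {l \<in> lines. p \<in> l} \<subseteq> m"
    using f by auto
  show "finite {l \<in> lines. p \<in> l}"
    using inj_on_finite[OF inj sub finite_line[OF m(1)]] .
  show "card {l \<in> lines. p \<in> l} \<le> q + 1"
    using card_inj_on_le[OF inj sub finite_line[OF m(1)]] card_line[OF m(1)] by simp
qed

text \<open>Each of the other lines removes at most one of the \<open>q + 1\<close> points of \<open>l\<close>.\<close>

lemma exists_point_avoiding_lines:
  assumes "l \<in> lines" "D \<subseteq> lines" "l \<notin> D" "finite D" "card D \<le> q"
  obtains x where "x \<in> l" "\<And>d. d \<in> D \<Longrightarrow> x \<notin> d"
proof -
  define f where "f d = (THE x. x \<in> l \<and> x \<in> d)" for d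
  have f: "x = f d" if "d \<in> D" "x \<in> l" "x \<in> d" for x d
    using the1_equality[OF unique_point[of l d]] that assms unfolding f_def by blast
  have "card (f ` D) < card l"
    using card_image_le[OF assms(4), of f] assms(5) card_line[OF assms(1)] by simp
  then have "\<not> l \<subseteq> f ` D"
    using card_mono[of "f ` D" l] assms(4) by auto
  then show ?thesis using that f by blast
qed

end

section \<open>Gears with too many spokes\<close>

lemma (in projective_plane_of_order) gear_embeds_imp_le:
  assumes "embeds (gear_graph n) points lines"
  shows "n \<le> q + 1"
proof -
  obtain \<psi> where \<psi>: "\<psi> ` gear_vertices n \<subseteq> points" "inj_on \<psi> (gear_vertices n)"
    "inj_on (induced_line lines \<psi>) (gear_edges n)"
    using assms by (auto simp: embeds_def embedding_def gear_graph_def)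
  define spoke where "spoke j = {Center, Rim (2 * j + 1)}" for j
  have spoke: "spoke ` {..<n} \<subseteq> gear_edges n"
    by (auto simp: gear_edges_def spoke_def)
  have C: "\<psi> Center \<in> points"
    using \<psi>(1) by (auto simp: gear_vertices_def)
  have line: "induced_line lines \<psi> (spoke j) \<in> {l \<in> lines. \<psi> Center \<in> l}" if "j < n" for j
  proof -
    have V: "Center \<in> gear_vertices n" "Rim (2 * j + 1) \<in> gear_vertices n"
      using that by (auto simp: gear_vertices_def)
    then have "\<psi> (Rim (2 * j + 1)) \<in> points" "\<psi> Center \<noteq> \<psi> (Rim (2 * j + 1))"
      using \<psi>(1) inj_onD[OF \<psi>(2), of Center "Rim (2 * j + 1)"] by auto
    then show ?thesis
      using C join[of "\<psi> Center"] by (simp add: spoke_def induced_line_doubleton)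
  qed
  have "inj_on spoke {..<n}"
    by (auto simp: inj_on_def spoke_def doubleton_eq_iff)
  then have "inj_on (induced_line lines \<psi> \<circ> spoke) {..<n}"
    using \<psi>(3) spoke by (blast intro: comp_inj_on inj_on_subset)
  then have "card {..<n} \<le> card {l \<in> lines. \<psi> Center \<in> l}"
    by (rule card_inj_on_le) (use line card_pencil_le(1)[OF C] in auto)
  then show ?thesis
    using card_pencil_le(2)[OF C] by simp
qed

section \<open>Bipartite graphs with one class on a line\<close>

text \<open>
  The line of an edge meets \<open>m\<close> in the image of exactly one vertex of \<open>A\<close>, so edges with different
  ends in \<open>A\<close> have different lines. Edges with the same end in \<open>A\<close> are separated by the last
  hypothesis.
\<close>

lemma (in projective_plane) embedding_if_one_class_on_line:
  assumes "m \<in> lines"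
    and V: "fst G = A \<union> B"
    and E: "\<And>e. e \<in> snd G \<Longrightarrow> \<exists>u\<in>A. \<exists>v\<in>B. e = {u, v}"
    and inj: "inj_on \<psi> A" "inj_on \<psi> B"
    and A: "\<psi> ` A \<subseteq> m" and B: "\<psi> ` B \<subseteq> points - m"
    and local_condition: "\<And>u v w. \<lbrakk>u \<in> A; v \<in> B; w \<in> B; {u, v} \<in> snd G; {u, w} \<in> snd G; v \<noteq> w\<rbrakk>
      \<Longrightarrow> \<not> collinear (\<psi> u) (\<psi> v) (\<psi> w)"
  shows "embedding G points lines \<psi>"
proof -
  have pts: "\<psi> u \<in> points" "\<psi> v \<in> points" "\<psi> u \<in> m" "\<psi> v \<notin> m" "\<psi> u \<noteq> \<psi> v"
    if "u \<in> A" "v \<in> B" for u v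
    using that A B lines_subset[OF assms(1)] by auto
  have "inj_on (induced_line lines \<psi>) (snd G)"
  proof (rule inj_onI)
    fix e f assume e: "e \<in> snd G" and f: "f \<in> snd G"
      and eq: "induced_line lines \<psi> e = induced_line lines \<psi> f"
    obtain u v where uv: "u \<in> A" "v \<in> B" "e = {u, v}" using E[OF e] by blast
    obtain x w where xw: "x \<in> A" "w \<in> B" "f = {x, w}" using E[OF f] by blast
    note p = pts[OF uv(1,2)] and r = pts[OF xw(1,2)]
    define l where "l = join (\<psi> u) (\<psi> v)"
    have l: "l \<in> lines" "\<psi> u \<in> l" "\<psi> v \<in> l"
      using join p by (auto simp: l_def)
    have "l = join (\<psi> x) (\<psi> w)"
      using eq p r by (simp add: l_def uv xw induced_line_doubleton)
    then have l': "\<psi> x \<in> l" "\<psi> w \<in> l"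
      using join r by auto
    have "\<psi> u = \<psi> x"
      using same_line[OF l(1) assms(1) l(2) l'(1)] p r l by blast
    then have ux: "u = x"
      using inj(1) uv xw by (auto dest: inj_onD)
    have "v = w"
    proof (rule ccontr)
      assume "v \<noteq> w"
      then have "\<not> collinear (\<psi> u) (\<psi> v) (\<psi> w)"
        using local_condition uv xw ux e f by blast
      then show False using l l' unfolding collinear_def by blast
    qed
    then show "e = f" using ux uv xw by simp
  qed
  moreover have "inj_on \<psi> (fst G)"
    unfolding V by (rule inj_on_Un[THEN iffD2]) (use inj A B in auto)
  moreover have "\<psi> ` fst G \<subseteq> points"
    using A B lines_subset[OF assms(1)] by (auto simp: V)
  ultimately show ?thesis by (simp add: embedding_def)
qed

text \<open>
  The same criterion in the case of gears: \<open>a i\<close> is the image of \<open>Rim (2 * i - 1)\<close>, and \<open>b i\<close> that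
  of its successor on the rim. The predecessor on the rim is \<open>b (i - 1)\<close>, or \<open>b n\<close> for \<open>i = 1\<close>.
\<close>

lemma (in projective_plane) gear_embeds_if:
  assumes "m \<in> lines" "C \<in> points" "C \<notin> m" and "n \<ge> 1"
    and a: "inj_on a {1..n}" "a ` {1..n} \<subseteq> m"
    and b: "inj_on b {1..n}" "b ` {1..n} \<subseteq> points - m - {C}"
    and C_succ: "\<And>i. i \<in> {1..n} \<Longrightarrow> \<not> collinear (a i) C (b i)"
    and C_pred: "\<And>i. i \<in> {1..n} \<Longrightarrow> \<not> collinear (a i) C (b (if i = 1 then n else i - 1))"
    and succ_pred: "\<And>i. i \<in> {1..n} \<Longrightarrow> \<not> collinear (a i) (b i) (b (if i = 1 then n else i - 1))"
  shows "embeds (gear_graph n) points lines"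
proof -
  define A where "A = (\<lambda>i. Rim (2 * i - 1)) ` {1..n}"
  define B where "B = insert Center ((\<lambda>i. Rim (2 * i)) ` {1..n})"
  define \<psi> where "\<psi> x = (case x of Center \<Rightarrow> C
    | Rim j \<Rightarrow> if odd j then a ((j + 1) div 2) else b (j div 2))" for x
  have \<psi>: "\<psi> Center = C" "\<psi> (Rim (2 * i)) = b i"
    "i \<in> {1..n} \<Longrightarrow> \<psi> (Rim (2 * i - 1)) = a i" for i
    by (auto simp: \<psi>_def)
  have V: "gear_vertices n = A \<union> B"
  proof -
    have "{1..2 * n} = (\<lambda>i. 2 * i - 1) ` {1..n} \<union> (\<lambda>i. 2 * i) ` {1..n}"
    proof (intro equalityI subsetI)
      fix j assume j: "j \<in> {1..2 * n}"
      show "j \<in> (\<lambda>i. 2 * i - 1) ` {1..n} \<union> (\<lambda>i. 2 * i) ` {1..n}"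
      proof (cases "odd j")
        case True
        then have "j = 2 * ((j + 1) div 2) - 1" "(j + 1) div 2 \<in> {1..n}"
          using j by (auto elim!: oddE)
        then show ?thesis by blast
      next
        case False
        then have "j = 2 * (j div 2)" "j div 2 \<in> {1..n}"
          using j by (auto elim!: evenE)
        then show ?thesis by blast
      qed
    qed auto
    then have "Rim ` {1..2 * n} = A \<union> (\<lambda>i. Rim (2 * i)) ` {1..n}"
      by (simp add: A_def image_Un image_image)
    then show ?thesis by (simp add: gear_vertices_def B_def)
  qed
  have E: "\<exists>i\<in>{1..n}. \<exists>v\<in>{Center, Rim (2 * i), Rim (2 * (if i = 1 then n else i - 1))}.
    e = {Rim (2 * i - 1), v}" if "e \<in> gear_edges n" for e
  proof -
    consider j where "e = {Rim j, Rim (j + 1)}" "1 \<le> j" "j < 2 * n"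
      | "e = {Rim (2 * n), Rim 1}"
      | j where "e = {Center, Rim j}" "1 \<le> j" "j \<le> 2 * n" "odd j"
      using \<open>e \<in> gear_edges n\<close> unfolding gear_edges_def by blast
    then show ?thesis
    proof cases
      case 1
      show ?thesis
      proof (cases "odd j")
        case True
        then obtain i where "j = 2 * i + 1" by (rule oddE)
        then show ?thesis using 1 by (intro bexI[of _ "i + 1"] bexI[of _ "Rim (j + 1)"]) auto
      next
        case False
        then obtain i where "j = 2 * i" by (blast elim: evenE)
        then show ?thesis using 1
          by (intro bexI[of _ "i + 1"] bexI[of _ "Rim j"]) auto
      qed
    next
      case 2
      then show ?thesis using \<open>n \<ge> 1\<close>
        by (intro bexI[of _ 1] bexI[of _ "Rim (2 * n)"]) auto
    next
      case 3
      then obtain i where "j = 2 * i + 1" by (blast elim: oddE)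
      then show ?thesis using 3 by (intro bexI[of _ "i + 1"] bexI[of _ Center]) auto
    qed
  qed
  have nbr: "v \<in> {Center, Rim (2 * i), Rim (2 * (if i = 1 then n else i - 1))}"
    if e: "{Rim (2 * i - 1), v} \<in> gear_edges n" and "i \<in> {1..n}" "v \<in> B" for i v
  proof -
    obtain i' v' where *: "i' \<in> {1..n}"
      "v' \<in> {Center, Rim (2 * i'), Rim (2 * (if i' = 1 then n else i' - 1))}"
      "{Rim (2 * i - 1), v} = {Rim (2 * i' - 1), v'}"
      using E[OF e] by blast
    have "Rim (2 * i - 1) \<noteq> v'"
    proof
      assume "Rim (2 * i - 1) = v'"
      then obtain j where "2 * i - 1 = 2 * j" using *(2) by auto
      then show False using \<open>i \<in> {1..n}\<close> by auto presburger
    qed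
    then have "Rim (2 * i - 1) = Rim (2 * i' - 1)" "v = v'"
      using *(3) by (auto simp: doubleton_eq_iff)
    moreover then have "i = i'" using \<open>i \<in> {1..n}\<close> \<open>i' \<in> {1..n}\<close> by auto
    ultimately show ?thesis using *(2) by (simp only:)
  qed
  have "embedding (gear_graph n) points lines \<psi>"
  proof (rule embedding_if_one_class_on_line[OF \<open>m \<in> lines\<close>, of _ A B])
    show "fst (gear_graph n) = A \<union> B"
      by (simp add: gear_graph_def V)
    show "\<exists>u\<in>A. \<exists>v\<in>B. e = {u, v}" if e: "e \<in> snd (gear_graph n)" for e
    proof -
      obtain i v where iv: "i \<in> {1..n}" "e = {Rim (2 * i - 1), v}"
        "v \<in> {Center, Rim (2 * i), Rim (2 * (if i = 1 then n else i - 1))}"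
        using E[OF e[unfolded gear_graph_def snd_conv]] by blast
      moreover have "(if i = 1 then n else i - 1) \<in> {1..n}"
        using iv(1) by auto
      ultimately have "Rim (2 * i - 1) \<in> A" "v \<in> B"
        unfolding A_def B_def by blast+
      then show ?thesis using iv by blast
    qed
    have "inj_on (\<psi> \<circ> (\<lambda>i. Rim (2 * i - 1))) {1..n}"
      by (rule inj_on_cong[THEN iffD2, OF _ a(1)]) (simp only: comp_apply \<psi>(3))
    then show "inj_on \<psi> A"
      unfolding A_def by (rule inj_on_imageI)
    have "inj_on \<psi> ((\<lambda>i. Rim (2 * i)) ` {1..n})"
      using b(1) by (intro inj_on_imageI) (simp only: comp_def \<psi>(2))
    moreover have "\<psi> Center \<notin> \<psi> ` (\<lambda>i. Rim (2 * i)) ` {1..n}"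
      using b(2) unfolding image_image \<psi>(1,2) by blast
    ultimately show "inj_on \<psi> B"
      unfolding B_def inj_on_insert by blast
    show "\<psi> ` A \<subseteq> m"
      using a(2) \<psi>(3) unfolding A_def image_image by blast
    show "\<psi> ` B \<subseteq> points - m"
      using b(2) assms(2,3) by (auto simp: B_def \<psi>)
    show "\<not> collinear (\<psi> u) (\<psi> v) (\<psi> w)"
      if "u \<in> A" "v \<in> B" "w \<in> B" "{u, v} \<in> snd (gear_graph n)" "{u, w} \<in> snd (gear_graph n)"
        "v \<noteq> w" for u v w
    proof -
      obtain i where i: "i \<in> {1..n}" "u = Rim (2 * i - 1)"
        using \<open>u \<in> A\<close> by (auto simp: A_def)
      define p where "p = (if i = 1 then n else i - 1)"
      have "v \<in> {Center, Rim (2 * i), Rim (2 * p)}" "w \<in> {Center, Rim (2 * i), Rim (2 * p)}"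
        using nbr i that unfolding p_def gear_graph_def snd_conv by blast+
      moreover have "\<not> collinear (a i) C (b i)" "\<not> collinear (a i) C (b p)"
        "\<not> collinear (a i) (b i) (b p)"
        using C_succ C_pred succ_pred i(1) unfolding p_def by blast+
      moreover have "\<psi> u = a i"
        unfolding i(2) by (rule \<psi>(3)[OF i(1)])
      ultimately show ?thesis
        using \<open>v \<noteq> w\<close> by (auto simp: \<psi>(1,2) collinear_swap)
    qed
  qed
  then show ?thesis by (auto simp: embeds_def)
qed

section \<open>The gear with as many spokes as lines through a point\<close>

lemma (in projective_plane_of_order) gear_embeds:
  assumes "q \<ge> 4"
  shows "embeds (gear_graph (q + 1)) points lines"
proof -
  have idx: "1 \<in> {1..q + 1}" "2 \<in> {1..q + 1}" "q \<in> {1..q + 1}" "q + 1 \<in> {1..q + 1}"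
    "1 \<in> {1..q - 1}" "q - 1 \<in> {1..q - 1}"
    using assms by auto
  obtain C where C: "C \<in> points" using exists_point .
  obtain m where m: "m \<in> lines" "C \<notin> m" using exists_line_avoiding_point[OF C] .
  obtain a where a: "bij_betw a {1..q + 1} m"
    using ex_bij_betw_nat_finite_1[OF finite_line[OF m(1)]] card_line[OF m(1)] by auto
  have am: "a i \<in> m" "a i \<in> points" "a i \<noteq> C" if "i \<in> {1..q + 1}" for i
  proof -
    show "a i \<in> m" using bij_betwE[OF a] that by blast
    then show "a i \<in> points" "a i \<noteq> C" using m lines_subset by auto
  qed
  have a_inj: "a i \<noteq> a j" if "i \<in> {1..q + 1}" "j \<in> {1..q + 1}" "i \<noteq> j" for i j
    using that a by (auto simp: bij_betw_def inj_on_def)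
  define L where "L i = join C (a i)" for i
  have L: "L i \<in> lines" "C \<in> L i" "a i \<in> L i" if "i \<in> {1..q + 1}" for i
    using join C am[OF that] unfolding L_def by auto
  have aL: "a i \<notin> L j" if "i \<in> {1..q + 1}" "j \<in> {1..q + 1}" "i \<noteq> j" for i j
    using same_line[OF m(1) L(1), of j "a i" "a j"] am L m a_inj that by blast
  have LL: "L i \<noteq> L j" if "i \<in> {1..q + 1}" "j \<in> {1..q + 1}" "i \<noteq> j" for i j
    using aL L that by metis
  define k where "k = L (q + 1)"
  have k: "k \<in> lines" "C \<in> k" "a (q + 1) \<in> k"
    using L[of "q + 1"] by (auto simp: k_def)
  have km: "x = a (q + 1)" if "x \<in> k" "x \<in> m" for x
    using same_line[OF m(1) k(1), of x "a (q + 1)"] that k m am by auto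
  have "card (k - {C, a (q + 1)}) = q - 1"
    using k card_line[OF k(1)] am(3)[of "q + 1"] by (simp add: card_Diff_subset)
  then obtain b0 where b0: "bij_betw b0 {1..q - 1} (k - {C, a (q + 1)})"
    using ex_bij_betw_nat_finite_1[of "k - {C, a (q + 1)}"] finite_line[OF k(1)] by auto
  have b0k: "b0 i \<in> k" "b0 i \<noteq> C" "b0 i \<notin> m" "b0 i \<in> points" if "i \<in> {1..q - 1}" for i
  proof -
    have "b0 i \<in> k - {C, a (q + 1)}" using bij_betwE[OF b0] that by blast
    then show "b0 i \<in> k" "b0 i \<noteq> C" "b0 i \<notin> m" "b0 i \<in> points"
      using km lines_subset[OF k(1)] by auto
  qed
  have join_ab0: "join (a i) (b0 j) \<in> lines" "a i \<in> join (a i) (b0 j)"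
    if "i \<in> {1..q + 1}" "j \<in> {1..q - 1}" for i j
    using join[of "a i" "b0 j"] am(1,2)[OF that(1)] b0k(3,4)[OF that(2)] by metis+
  \<comment> \<open>The point \<open>u\<close> becomes \<open>b q\<close>. It avoids \<open>k\<close> in order to differ from \<open>C\<close> and all points \<open>b0 i\<close>,
    and the last line in order to be seen from \<open>a q\<close> along another line than \<open>b (q - 1)\<close>.\<close>
  have "\<exists>u. u \<in> L 1 \<and> u \<notin> m \<and> u \<notin> k \<and> u \<notin> join (a q) (b0 (q - 1))"
  proof -
    let ?D = "{m, k, join (a q) (b0 (q - 1))}"
    have "L 1 \<noteq> m" "L 1 \<noteq> k" "L 1 \<noteq> join (a q) (b0 (q - 1))"
      using L(2)[OF idx(1)] m(2) LL[OF idx(1,4)] aL[OF idx(3,1)] join_ab0(2)[OF idx(3,6)] assms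
      by (auto simp: k_def)
    then have ne: "L 1 \<notin> ?D" "?D \<subseteq> lines"
      using m(1) k(1) join_ab0(1)[OF idx(3,6)] by blast+
    have "card ?D \<le> q"
      using card_length[of "[m, k, join (a q) (b0 (q - 1))]"] assms by simp
    then show ?thesis
      using exists_point_avoiding_lines[OF L(1)[OF idx(1)] ne(2,1)]
      by (metis finite.emptyI finite.insertI insertCI)
  qed
  then obtain u where u: "u \<in> L 1" "u \<notin> m" "u \<notin> k" "u \<notin> join (a q) (b0 (q - 1))"
    by blast
  have u': "u \<in> points" "u \<noteq> C" using u lines_subset[OF L(1)[of 1]] k by auto
  have join_au: "join (a (q + 1)) u \<in> lines" "a (q + 1) \<in> join (a (q + 1)) u"
    using join[of "a (q + 1)" u] am[of "q + 1"] u u' by auto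
  \<comment> \<open>Likewise, \<open>v\<close> becomes \<open>b (q + 1)\<close>, whose rim neighbours are \<open>a (q + 1)\<close> and \<open>a 1\<close>.\<close>
  have "\<exists>v. v \<in> L 2 \<and> v \<notin> m \<and> v \<notin> k \<and> v \<notin> join (a 1) (b0 1) \<and> v \<notin> join (a (q + 1)) u"
  proof -
    let ?D = "{m, k, join (a 1) (b0 1), join (a (q + 1)) u}"
    have "L 2 \<noteq> m" "L 2 \<noteq> k" "L 2 \<noteq> join (a 1) (b0 1)" "L 2 \<noteq> join (a (q + 1)) u"
      using L(2)[OF idx(2)] m(2) LL[OF idx(2,4)] aL[OF idx(1,2)] aL[OF idx(4,2)]
        join_ab0(2)[OF idx(1,5)] join_au(2) assms
      by (auto simp: k_def)
    then have ne: "L 2 \<notin> ?D" "?D \<subseteq> lines"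
      using m(1) k(1) join_ab0(1)[OF idx(1,5)] join_au(1) by blast+
    have "card ?D \<le> q"
      using card_length[of "[m, k, join (a 1) (b0 1), join (a (q + 1)) u]"] assms by simp
    then show ?thesis
      using exists_point_avoiding_lines[OF L(1)[OF idx(2)] ne(2,1)]
      by (metis finite.emptyI finite.insertI insertCI)
  qed
  then obtain v where v: "v \<in> L 2" "v \<notin> m" "v \<notin> k" "v \<notin> join (a 1) (b0 1)"
    "v \<notin> join (a (q + 1)) u"
    by blast
  have v': "v \<in> points" "v \<noteq> C" using v lines_subset[OF L(1)[of 2]] k assms by auto
  have uv: "u \<noteq> v"
    using same_line[of "L 1" "L 2" C u] LL[of 1 2] L[of 1] L[of 2] u v u' assms by auto
  have off_k: "\<not> collinear (a i) x y" if "i \<in> {1..q}" "x \<in> k" "y \<in> k" "x \<noteq> y" for i x y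
    using not_collinear_off_line[OF k(1), of x y "a i"] aL[of i "q + 1"] that by (auto simp: k_def)
  have Cb0: "\<not> collinear (a i) C (b0 j)" if "i \<in> {1..q}" "j \<in> {1..q - 1}" for i j
    using off_k[OF that(1) k(2) b0k(1)[OF that(2)]] b0k(2)[OF that(2)] by metis
  have Cu: "\<not> collinear (a i) C u" if "i \<in> {1..q + 1}" "i \<noteq> 1" for i
    using not_collinear_off_line[of "L 1" C u "a i"] aL[of i 1] L[of 1] u u' that by auto
  have Cv: "\<not> collinear (a i) C v" if "i \<in> {1..q + 1}" "i \<noteq> 2" for i
    using not_collinear_off_line[of "L 2" C v "a i"] aL[of i 2] L[of 2] v v' that assms by auto
  have off_join: "\<not> collinear x y z"
    if "x \<in> points" "y \<in> points" "x \<noteq> y" "z \<notin> join x y" for x y z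
    using join[OF that(1-3)] same_line that unfolding collinear_def by blast
  have bu: "\<not> collinear (a q) (b0 (q - 1)) u"
    using off_join[OF am(2)[OF idx(3)] b0k(4)[OF idx(6)] _ u(4)] am(1)[OF idx(3)] b0k(3)[OF idx(6)]
    by metis
  have bv: "\<not> collinear (a 1) (b0 1) v"
    using off_join[OF am(2)[OF idx(1)] b0k(4)[OF idx(5)] _ v(4)] am(1)[OF idx(1)] b0k(3)[OF idx(5)]
    by metis
  have uv': "\<not> collinear (a (q + 1)) u v"
    using off_join[of "a (q + 1)" u v] v u u' am[of "q + 1"] by auto
  define b where "b i = (if i < q then b0 i else if i = q then u else v)" for i
  show ?thesis
  proof (rule gear_embeds_if[OF m(1) C m(2), of "q + 1" a b])
    show "1 \<le> q + 1" by simp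
    show "inj_on a {1..q + 1}" "a ` {1..q + 1} \<subseteq> m"
      using a by (auto simp: bij_betw_def)
    show "inj_on b {1..q + 1}"
    proof (rule inj_onI)
      fix i j assume ij: "i \<in> {1..q + 1}" "j \<in> {1..q + 1}" "b i = b j"
      have b0_inj: "i = j" if "i < q" "j < q" "b0 i = b0 j"
        using that b0 ij by (auto simp: bij_betw_def inj_on_def)
      have "b0 i' \<noteq> u" "b0 i' \<noteq> v" if "i' \<in> {1..q + 1}" "i' < q" for i'
      proof -
        have "b0 i' \<in> k" using b0k(1)[of i'] that by simp
        then show "b0 i' \<noteq> u" "b0 i' \<noteq> v" using u v by blast+
      qed
      then show "i = j"
        using b0_inj ij uv uv[symmetric] unfolding b_def by (auto split: if_splits; metis)
    qed
    show "b ` {1..q + 1} \<subseteq> points - m - {C}"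
    proof (rule image_subsetI)
      fix i assume "i \<in> {1..q + 1}"
      then show "b i \<in> points - m - {C}"
        using b0k(2-4)[of i] u(2) v(2) u' v' by (auto simp: b_def)
    qed
    fix i assume i: "i \<in> {1..q + 1}"
    define p where "p = (if i = 1 then q + 1 else i - 1)"
    consider "i = 1" | "2 \<le> i" "i < q" | "i = q" | "i = q + 1"
      using i by fastforce
    then have "\<not> collinear (a i) C (b i) \<and> \<not> collinear (a i) C (b p)
      \<and> \<not> collinear (a i) (b i) (b p)"
    proof cases
      case 1
      then have "b i = b0 1" "b p = v" using assms by (auto simp: b_def p_def)
      then show ?thesis
        using 1 Cb0[of 1 1] Cv[of 1] bv assms by auto
    next
      case 2
      then have "b i = b0 i" "b p = b0 (i - 1)" by (auto simp: b_def p_def)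
      moreover have mem: "i \<in> {1..q}" "i \<in> {1..q - 1}" "i - 1 \<in> {1..q - 1}"
        using 2 by auto
      moreover have "b0 i \<noteq> b0 (i - 1)"
        using inj_onD[OF bij_betw_imp_inj_on[OF b0] _ mem(2,3)] 2 by auto
      ultimately show ?thesis
        by (metis Cb0 off_k b0k(1))
    next
      case 3
      then have "b i = u" "b p = b0 (q - 1)" using assms by (auto simp: b_def p_def)
      then show ?thesis
        using 3 Cb0[of q "q - 1"] Cu[of q] bu assms
        by (auto simp: collinear_swap)
    next
      case 4
      then have "b i = v" "b p = u" using assms by (auto simp: b_def p_def)
      then show ?thesis
        using 4 Cu[of "q + 1"] Cv[of "q + 1"] uv' assms by (auto simp: collinear_swap)
    qed
    then show "\<not> collinear (a i) C (b i)"
      "\<not> collinear (a i) C (b (if i = 1 then q + 1 else i - 1))"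
      "\<not> collinear (a i) (b i) (b (if i = 1 then q + 1 else i - 1))"
      unfolding p_def by blast+
  qed
qed

theorem theorem6:
  fixes q :: nat and points :: "'p set" and lines :: "'p set set"
  assumes "q > 4"
    and "projective_plane_of_order q points lines"
  shows "embeds (gear_graph (q + 1)) points lines \<and>
    (\<forall>n. n > q + 1 \<longrightarrow> \<not> embeds (gear_graph n) points lines)"
proof -
  interpret projective_plane_of_order q points lines by (fact assms(2))
  show ?thesis
    using gear_embeds gear_embeds_imp_le assms(1) by (meson less_imp_le not_le)
qed

end
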